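(* Let $H_V=\mathbb R$ and $V\varphi=(v,\varphi)_0$ for some $v\in H_0$, let $G\subset F_0\times F_1$ be bounded, and for each $T>0$ let $G_1=\{R_\eta:\int_0^TE(Q(t)\eta(t),\eta(t))_H\,dt\le\gamma_T^2\}$ and $B_T=\int_0^TC^\star(t)\Lambda_HQ(t)C(t)\,dt$. If $$\lim_{T\to\infty}\gamma_T^{-2}\inf_{\psi\in H_0:\|\psi\|_0=1}(B_T\psi,\psi)_0=+\infty,$$ then $$\lim_{T\to\infty}\ \inf_{u\in L^2(0,T,H),\,c\in\mathbb R}\ \sup_{[f_0,f_1]\in G,\,R_\eta\in G_1}E\Big((v,\varphi)_0-\int_0^T(u(t),y(t))_H\,dt-c\Big)^2=0.$$
   Context: All Hilbert spaces are real; $\mathscr L(X,Y)$ denotes bounded linear operators; $\langle\cdot,\cdot\rangle$ is the duality pairing between a Hilbert space and its dual; for $A\in\mathscr L(X,Y)$, $A^\star\in\mathscr L(Y^\star,X^\star)$ is its adjoint. Abstract Neumann problem. $H_+\subseteq H_0\subseteq H_-$ are Hilbert spaces (continuous embeddings) with inner products $(\cdot,\cdot)_+,(\cdot,\cdot)_0,(\cdot,\cdot)_-$; $H_0$ is identified with $H_0^\star$. $a$ is a continuous bilinear form on $H_+\times H_+$ with $a(\phi,\phi)\ge\alpha^2(\phi,\phi)_+$ for all $\phi\in H_+$ and some $\alpha\neq0$. $H_\partial$ is a Hilbert space, $\gamma\in\mathscr L(H_+,H_\partial)$ is surjective, and $\mathring H_+:=\ker\gamma$ is dense in $H_0$; $\mathring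 H_-:=\mathring H_+^\star$, so $\mathring H_+\subseteq H_0\subseteq\mathring H_-$. For $\phi\in H_+$ put $N\phi:=a(\phi,\cdot)\in\mathring H_-$ (a functional on $\mathring H_+$); $H_+(N):=\{\phi\in H_+:N\phi\in H_0\}$, with graph norm. $\delta\in\mathscr L(H_+(N),H_\partial^\star)$ is the operator determined by the Green formula $a(\phi,\psi)=(N\phi,\psi)_0+\langle\delta\phi,\gamma\psi\rangle$ for $\phi\in H_+(N),\psi\in H_+$. State and observations. $F_0,F_1,H$ are Hilbert spaces, $B_0\in\mathscr L(F_0,H_\partial^\star)$, $B_1\in\mathscr L(F_1,H_0)$, $T>0$. The state $\varphi\in H_+(N)$ is the unique solution of $N\varphi=B_1f_1$, $\delta\varphi=B_0f_0$, with uncertain $[f_0,f_1]\in G\subset F_0\times F_1$. One observes $y(t)=C(t)\varphi+\eta(t)$, $t\in[0,T]$, where $C(t)\in\mathscr L(H_0,H)$ is given (all integrals being assumed well defined) and $\eta$ is an $H$-valued random process with $E\eta(t)=0$, $\int_0^TE\|\eta(t)\|_H^2dt<\infty$, whose correlation operator $R_\eta$, $(R_\eta(t,s)x_1,x_2)_H=E(\eta(t),x_1)_H(\eta(s),x_2)_H$, is unknown and belongs to the given set $G_1$. $\Lambda_H:H\to H^\star$ is the canonical (Riesz) isomorphism. $Q(t)\in\mathscr L(H)$ satisfies $Q(t)=Q^\star(t)\ge\alpha^2I$ (self-adjoint, with some $\alpha\neq0$ independent of $t$), $t\mapsto\|Q(t)\|$ is continuous, and $\gamma_T$ is a given positive number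 for each $T$. *)

theory Defs
  imports "HOL-Probability.Probability"
begin

section \<open>Duality\<close>

text \<open>The dual of \<open>X\<close> is \<open>X \<Rightarrow>\<^sub>L real\<close>. A Hilbert space that is identified with its dual
  is identified along \<open>riesz\<close>, with inverse \<open>inv riesz\<close>.\<close>

definition riesz :: "'a::real_inner \<Rightarrow> ('a \<Rightarrow>\<^sub>L real)" where
  "riesz x = blinfun_inner_left x"

definition dual_adjoint ::
    "('a::real_normed_vector \<Rightarrow>\<^sub>L 'b::real_normed_vector) \<Rightarrow> ('b \<Rightarrow>\<^sub>L real) \<Rightarrow> ('a \<Rightarrow>\<^sub>L real)" where
  "dual_adjoint A g = g o\<^sub>L A"


section \<open>Vector-valued integrals\<close>

text \<open>The Hilbert spaces are not assumed to be separable, whereas \<^const>\<open>integrable\<close> and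
  \<^const>\<open>lebesgue_integral\<close> require a second countable codomain. Vector-valued integrals
  are therefore taken in the weak sense; they agree with the Bochner integral for strongly
  measurable functions with integrable norm.\<close>

definition strongly_measurable :: "'a measure \<Rightarrow> ('a \<Rightarrow> 'b::real_normed_vector) \<Rightarrow> bool" where
  "strongly_measurable N f \<longleftrightarrow>
     (\<exists>s. (\<forall>i::nat. simple_function N (s i)) \<and> (\<forall>x\<in>space N. (\<lambda>i. s i x) \<longlonglongrightarrow> f x))"

definition has_weak_integral :: "'a measure \<Rightarrow> ('a \<Rightarrow> 'b::real_inner) \<Rightarrow> 'b \<Rightarrow> bool" where
  "has_weak_integral N f x \<longleftrightarrow> (\<forall>y. has_bochner_integral N (\<lambda>s. f s \<bullet> y) (x \<bullet> y))"

definition weak_integral :: "'a measure \<Rightarrow> ('a \<Rightarrow> 'b::real_inner) \<Rightarrow> 'b" where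
  "weak_integral N f = (THE x. has_weak_integral N f x)"


section \<open>The abstract Neumann problem\<close>

text \<open>Here \<open>j\<close> is the embedding of \<open>H\<^sub>+\<close> into \<open>H\<^sub>0\<close>, \<open>a\<close> the bilinear form and \<open>\<gamma>\<close> the trace operator.
  Elements of the dual of \<open>ker \<gamma>\<close> are represented by functions on \<open>H\<^sub>+\<close> that are \<open>undefined\<close>
  outside of \<open>ker \<gamma>\<close>.\<close>

definition Hring_plus :: "('p::real_inner \<Rightarrow>\<^sub>L 'd::real_inner) \<Rightarrow> 'p set" where
  "Hring_plus \<gamma> = {\<psi>. blinfun_apply \<gamma> \<psi> = 0}"

definition neumann_op ::
    "('p::real_inner \<Rightarrow> 'p \<Rightarrow> real) \<Rightarrow> ('p \<Rightarrow>\<^sub>L 'd::real_inner) \<Rightarrow> 'p \<Rightarrow> ('p \<Rightarrow> real)" where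
  "neumann_op a \<gamma> \<phi> = restrict (a \<phi>) (Hring_plus \<gamma>)"

text \<open>The embedding of \<open>H\<^sub>0\<close> into the dual of \<open>ker \<gamma>\<close>; it is injective when \<open>ker \<gamma>\<close> is dense in \<open>H\<^sub>0\<close>.\<close>

definition emb_H0 ::
    "('p::real_inner \<Rightarrow>\<^sub>L 'h::real_inner) \<Rightarrow> ('p \<Rightarrow>\<^sub>L 'd::real_inner) \<Rightarrow> 'h \<Rightarrow> ('p \<Rightarrow> real)" where
  "emb_H0 j \<gamma> h = restrict (\<lambda>\<psi>. h \<bullet> blinfun_apply j \<psi>) (Hring_plus \<gamma>)"

definition Hplus_N ::
    "('p::real_inner \<Rightarrow>\<^sub>L 'h::real_inner) \<Rightarrow> ('p \<Rightarrow> 'p \<Rightarrow> real) \<Rightarrow> ('p \<Rightarrow>\<^sub>L 'd::real_inner) \<Rightarrow> 'p set" where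
  "Hplus_N j a \<gamma> = {\<phi>. neumann_op a \<gamma> \<phi> \<in> range (emb_H0 j \<gamma>)}"

text \<open>For \<open>\<phi>\<close> in \<open>Hplus_N\<close>, the functional \<open>N\<phi>\<close> as an element of \<open>H\<^sub>0\<close>.\<close>

definition neumann_op_H0 ::
    "('p::real_inner \<Rightarrow>\<^sub>L 'h::real_inner) \<Rightarrow> ('p \<Rightarrow> 'p \<Rightarrow> real) \<Rightarrow> ('p \<Rightarrow>\<^sub>L 'd::real_inner) \<Rightarrow> 'p \<Rightarrow> 'h" where
  "neumann_op_H0 j a \<gamma> \<phi> = (THE h. emb_H0 j \<gamma> h = neumann_op a \<gamma> \<phi>)"

text \<open>The conormal derivative, determined on \<open>Hplus_N\<close> by the Green formula because \<open>\<gamma>\<close> is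
  surjective.\<close>

definition conormal ::
    "('p::real_inner \<Rightarrow>\<^sub>L 'h::real_inner) \<Rightarrow> ('p \<Rightarrow> 'p \<Rightarrow> real) \<Rightarrow> ('p \<Rightarrow>\<^sub>L 'd::real_inner)
      \<Rightarrow> 'p \<Rightarrow> ('d \<Rightarrow>\<^sub>L real)" where
  "conormal j a \<gamma> \<phi> =
     (THE d. \<forall>\<psi>. a \<phi> \<psi> = neumann_op_H0 j a \<gamma> \<phi> \<bullet> blinfun_apply j \<psi>
                    + blinfun_apply d (blinfun_apply \<gamma> \<psi>))"

definition neumann_state ::
    "('p::real_inner \<Rightarrow>\<^sub>L 'h::real_inner) \<Rightarrow> ('p \<Rightarrow> 'p \<Rightarrow> real) \<Rightarrow> ('p \<Rightarrow>\<^sub>L 'd::real_inner)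
      \<Rightarrow> ('f0::real_inner \<Rightarrow>\<^sub>L ('d \<Rightarrow>\<^sub>L real)) \<Rightarrow> ('f1::real_inner \<Rightarrow>\<^sub>L 'h)
      \<Rightarrow> 'f0 \<Rightarrow> 'f1 \<Rightarrow> 'p" where
  "neumann_state j a \<gamma> B0 B1 f0 f1 =
     (THE \<phi>. \<phi> \<in> Hplus_N j a \<gamma> \<and> neumann_op_H0 j a \<gamma> \<phi> = blinfun_apply B1 f1
              \<and> conormal j a \<gamma> \<phi> = blinfun_apply B0 f0)"


section \<open>Observations\<close>

definition L2_on :: "real \<Rightarrow> (real \<Rightarrow> 'k::real_inner) set" where
  "L2_on T = {u. strongly_measurable (lebesgue_on {0..T}) u
                  \<and> (\<integral>\<^sup>+t. ennreal ((norm (u t))\<^sup>2) \<partial>lebesgue_on {0..T}) < \<infinity>}"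

text \<open>Joint strong measurability implies that each \<open>\<eta>(t)\<close> is strongly measurable, so the last
  condition says that \<open>\<eta>(t)\<close> is Bochner integrable with expectation 0.\<close>

definition noise_process ::
    "'w measure \<Rightarrow> real \<Rightarrow> (real \<Rightarrow> 'w \<Rightarrow> 'k::real_inner) \<Rightarrow> bool" where
  "noise_process M T \<eta> \<longleftrightarrow>
     strongly_measurable (lebesgue_on {0..T} \<Otimes>\<^sub>M M) (\<lambda>(t, \<omega>). \<eta> t \<omega>)
     \<and> (\<integral>\<^sup>+t. (\<integral>\<^sup>+\<omega>. ennreal ((norm (\<eta> t \<omega>))\<^sup>2) \<partial>M) \<partial>lebesgue_on {0..T}) < \<infinity>
     \<and> (\<forall>t\<in>{0..T}. (\<integral>\<^sup>+\<omega>. ennreal (norm (\<eta> t \<omega>)) \<partial>M) < \<infinity> \<and> has_weak_integral M (\<eta> t) 0)"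

definition is_correlation_op ::
    "'w measure \<Rightarrow> real \<Rightarrow> (real \<Rightarrow> 'w \<Rightarrow> 'k::real_inner) \<Rightarrow> (real \<Rightarrow> real \<Rightarrow> 'k \<Rightarrow>\<^sub>L 'k) \<Rightarrow> bool" where
  "is_correlation_op M T \<eta> R \<longleftrightarrow>
     (\<forall>t\<in>{0..T}. \<forall>s\<in>{0..T}. \<forall>x1 x2.
        integrable M (\<lambda>\<omega>. (\<eta> t \<omega> \<bullet> x1) * (\<eta> s \<omega> \<bullet> x2))
        \<and> blinfun_apply (R t s) x1 \<bullet> x2 = (\<integral>\<omega>. (\<eta> t \<omega> \<bullet> x1) * (\<eta> s \<omega> \<bullet> x2) \<partial>M))"

text \<open>The set \<open>G\<^sub>1\<close> for the bound \<open>g = \<gamma>\<^sub>T\<close>.\<close>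

definition correlation_set ::
    "'w measure \<Rightarrow> real \<Rightarrow> (real \<Rightarrow> 'k::real_inner \<Rightarrow>\<^sub>L 'k) \<Rightarrow> real \<Rightarrow> (real \<Rightarrow> real \<Rightarrow> 'k \<Rightarrow>\<^sub>L 'k) set" where
  "correlation_set M T Q g =
     {R. \<exists>\<eta>. noise_process M T \<eta> \<and> is_correlation_op M T \<eta> R
            \<and> (\<integral>\<^sup>+t. (\<integral>\<^sup>+\<omega>. ennreal (blinfun_apply (Q t) (\<eta> t \<omega>) \<bullet> \<eta> t \<omega>) \<partial>M)
                 \<partial>lebesgue_on {0..T}) \<le> ennreal (g\<^sup>2)}"

definition admissible_noise ::
    "'w measure \<Rightarrow> real \<Rightarrow> (real \<Rightarrow> real \<Rightarrow> 'k::real_inner \<Rightarrow>\<^sub>L 'k) set \<Rightarrow> (real \<Rightarrow> 'w \<Rightarrow> 'k) set" where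
  "admissible_noise M T G1 =
     {\<eta>. noise_process M T \<eta> \<and> (\<exists>R\<in>G1. is_correlation_op M T \<eta> R)}"

definition observation ::
    "(real \<Rightarrow> 'h::real_inner \<Rightarrow>\<^sub>L 'k::real_inner) \<Rightarrow> 'h \<Rightarrow> (real \<Rightarrow> 'w \<Rightarrow> 'k) \<Rightarrow> real \<Rightarrow> 'w \<Rightarrow> 'k" where
  "observation C \<phi> \<eta> t \<omega> = blinfun_apply (C t) \<phi> + \<eta> t \<omega>"

text \<open>Mean square error of the estimate \<open>\<integral> (u,y) dt + c\<close> of \<open>(v,\<phi>)\<close>.\<close>

definition mean_square_error ::
    "'w measure \<Rightarrow> real \<Rightarrow> 'h::real_inner \<Rightarrow> 'h \<Rightarrow> (real \<Rightarrow> 'w \<Rightarrow> 'k::real_inner)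
      \<Rightarrow> (real \<Rightarrow> 'k) \<Rightarrow> real \<Rightarrow> ennreal" where
  "mean_square_error M T v \<phi> y u c =
     (\<integral>\<^sup>+\<omega>. ennreal ((v \<bullet> \<phi> - (\<integral>t. u t \<bullet> y t \<omega> \<partial>lebesgue_on {0..T}) - c)\<^sup>2) \<partial>M)"

text \<open>The integrand \<open>C\<^sup>\<star>(t) \<Lambda> Q(t) C(t) \<psi>\<close> of \<open>B\<^sub>T \<psi>\<close>. It is a functional on \<open>H\<^sub>0\<close>, viewed as an
  element of \<open>H\<^sub>0\<close>; the operator valued integral \<open>B\<^sub>T\<close> is taken pointwise in \<open>\<psi>\<close>.\<close>

definition gram_integrand ::
    "(real \<Rightarrow> 'h::real_inner \<Rightarrow>\<^sub>L 'k::real_inner) \<Rightarrow> (real \<Rightarrow> 'k \<Rightarrow>\<^sub>L 'k) \<Rightarrow> 'h \<Rightarrow> real \<Rightarrow> 'h" where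
  "gram_integrand C Q \<psi> t =
     inv riesz (dual_adjoint (C t) (riesz (blinfun_apply (Q t) (blinfun_apply (C t) \<psi>))))"

definition gram_op ::
    "(real \<Rightarrow> 'h::real_inner \<Rightarrow>\<^sub>L 'k::real_inner) \<Rightarrow> (real \<Rightarrow> 'k \<Rightarrow>\<^sub>L 'k) \<Rightarrow> real \<Rightarrow> 'h \<Rightarrow> 'h" where
  "gram_op C Q T \<psi> = weak_integral (lebesgue_on {0..T}) (gram_integrand C Q \<psi>)"

end

theory Submission
  imports Defs
begin

text \<open>The operator \<open>B\<^sub>T\<close> is symmetric and, for large \<open>T\<close>, coercive with constant \<open>K \<gamma>\<^sub>T\<^sup>2\<close>, so
  \<open>B\<^sub>T p = v\<close> has a solution \<open>p\<close>. The estimate with \<open>u = Q C p\<close> and \<open>c = 0\<close> is unbiased whatever the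
  state is, since \<open>\<integral> (u, C \<phi>) dt = (B\<^sub>T p, \<phi>)\<^sub>0 = (v, \<phi>)\<^sub>0\<close>; hence its mean square error is the second
  moment of \<open>\<integral> (u, \<eta>) dt\<close>. By Fubini this depends on \<open>\<eta>\<close> only through the correlation operator, so \<open>\<eta>\<close>
  may be replaced by a noise with the same correlation operator that satisfies the bound defining
  \<open>G\<^sub>1\<close>. The Cauchy--Schwarz inequality for the form of \<open>Q(t)\<close> then bounds the error by
  \<open>(B\<^sub>T p, p)\<^sub>0 \<gamma>\<^sub>T\<^sup>2 = (v, p)\<^sub>0 \<gamma>\<^sub>T\<^sup>2 \<le> \<parallel>v\<parallel>\<^sup>2 / K\<close>.\<close>

section \<open>Variational solution of symmetric coercive equations\<close>

text \<open>The solution comes from minimising the energy \<open>J x = b x x - 2 * l x\<close>: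
  coercivity bounds \<open>J\<close> below and makes minimising sequences Cauchy, and the first
  variation gives the equation in the limit. The lemma serves twice, for the Riesz representation
  and for solving \<open>gram_op C Q T p = v\<close>.\<close>

lemma symmetric_lax_milgram:
  fixes b :: "'a::{real_inner,complete_space} \<Rightarrow> 'a \<Rightarrow> real" and l :: "'a \<Rightarrow> real"
  assumes bl: "\<And>y. bounded_linear (\<lambda>x. b x y)"
    and sym: "\<And>x y. b x y = b y x"
    and coercive: "\<And>x. c * (norm x)\<^sup>2 \<le> b x x" and c: "c > 0"
    and l: "bounded_linear l"
  shows "\<exists>p. \<forall>y. b p y = l y"
proof -
  interpret L: bounded_linear l by (rule l)
  have lin: "b (x + x') y = b x y + b x' y" "b (x - x') y = b x y - b x' y"
    "b (r *\<^sub>R x) y = r * b x y" for x x' y r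
    using linear_add[OF bounded_linear.linear[OF bl]] linear_diff[OF bounded_linear.linear[OF bl]]
      linear_scale[OF bounded_linear.linear[OF bl]] by simp_all
  have lin2: "b y (x + x') = b y x + b y x'" "b y (x - x') = b y x - b y x'"
    "b y (r *\<^sub>R x) = r * b y x" for x x' y r
    using lin sym by metis+
  define J where "J x = b x x - 2 * l x" for x
  obtain K where K: "\<And>x. \<bar>l x\<bar> \<le> norm x * K" using L.bounded by auto
  have J_ge: "- (K\<^sup>2 / c) \<le> J x" for x
  proof -
    have "2 * l x \<le> 2 * (norm x * K)" using K[of x] by linarith
    moreover have "2 * (norm x * K) \<le> c * (norm x)\<^sup>2 + K\<^sup>2 / c"
    proof -
      have "0 \<le> (c * norm x - K)\<^sup>2 / c" using c by simp
      also have "\<dots> = c * (norm x)\<^sup>2 + K\<^sup>2 / c - 2 * (norm x * K)"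
        using c by (simp add: field_simps power2_eq_square)
      finally show ?thesis by simp
    qed
    ultimately show ?thesis using coercive[of x] by (simp add: J_def)
  qed
  then have bdd: "bdd_below (range J)" by (auto simp: bdd_below_def)
  define m where "m = Inf (range J)"
  have m_le: "m \<le> J x" for x
    unfolding m_def by (rule cInf_lower[OF _ bdd]) auto
  have "\<exists>x. J x < m + 1 / real (Suc n)" for n
    using cInf_lessD[of "range J" "m + 1 / real (Suc n)"] by (force simp: m_def)
  then obtain X where X: "\<And>n. J (X n) < m + 1 / real (Suc n)" by metis
  \<comment> \<open>by the parallelogram identity for \<open>b\<close>, minimizing sequences are Cauchy\<close>
  have dist_le: "c * (norm (x - y))\<^sup>2 \<le> 2 * (J x + J y) - 4 * m" for x y
  proof -
    define z where "z = (1/2) *\<^sub>R (x + y)"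
    have "2 * J x + 2 * J y - 4 * J z = b (x - y) (x - y)"
      by (simp add: J_def z_def lin lin2 L.add L.scaleR sym[of y x] field_simps)
    then have "c * (norm (x - y))\<^sup>2 \<le> 2 * J x + 2 * J y - 4 * J z"
      using coercive[of "x - y"] by simp
    also have "\<dots> \<le> 2 * J x + 2 * J y - 4 * m" using m_le[of z] by simp
    finally show ?thesis by simp
  qed
  have "Cauchy X"
  proof (rule metric_CauchyI)
    fix e :: real assume e: "e > 0"
    obtain N where N: "1 / real (Suc N) < c * e\<^sup>2 / 4"
      using c e by (metis (no_types) nat_approx_posE zero_less_divide_iff zero_less_mult_iff zero_less_numeral zero_less_power)
    have "dist (X i) (X k) < e" if "i \<ge> N" "k \<ge> N" for i k
    proof -
      have "1 / real (Suc i) \<le> 1 / real (Suc N)" "1 / real (Suc k) \<le> 1 / real (Suc N)"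
        using that by (auto simp: field_simps)
      then have "J (X i) + J (X k) - 2 * m < 2 * (c * e\<^sup>2 / 4)"
        using X[of i] X[of k] N by linarith
      then have "2 * (J (X i) + J (X k)) - 4 * m < c * e\<^sup>2" by simp
      with dist_le[of "X i" "X k"] have "c * (norm (X i - X k))\<^sup>2 < c * e\<^sup>2"
        by (rule le_less_trans)
      then show ?thesis
        using c e by (simp add: dist_norm power_less_imp_less_base)
    qed
    then show "\<exists>N. \<forall>i\<ge>N. \<forall>k\<ge>N. dist (X i) (X k) < e" by blast
  qed
  then obtain p where p: "X \<longlonglongrightarrow> p" using Cauchy_convergent convergent_def by blast
  have "b p y = l y" for y
  proof -
    define d where "d = b p y - l y"
    have bp: "(\<lambda>n. b (X n) y) \<longlonglongrightarrow> b p y"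
      using bl[of y] p by (rule bounded_linear.tendsto)
    \<comment> \<open>Moving from \<open>X n\<close> along \<open>y\<close> cannot lower
      \<open>J\<close> by more than \<open>1 / real (Suc n)\<close>. This is shown along the
      sequence and only then passed to the limit, which calls for continuity of \<open>b\<close> in
      its first argument at fixed \<open>y\<close>, not for continuity of \<open>J\<close>.\<close>
    have ge0: "0 \<le> 2 * t * d + t\<^sup>2 * b y y" for t
    proof (rule LIMSEQ_le_const)
      show "(\<lambda>n. 1 / real (Suc n) + 2 * t * (b (X n) y - l y) + t\<^sup>2 * b y y)
              \<longlonglongrightarrow> 2 * t * d + t\<^sup>2 * b y y"
        unfolding d_def
        by (rule tendsto_eq_intros bp LIMSEQ_Suc[OF lim_1_over_n] refl | simp)+
      have "0 \<le> 1 / real (Suc n) + 2 * t * (b (X n) y - l y) + t\<^sup>2 * b y y" for n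
      proof -
        have "J (X n + t *\<^sub>R y) = J (X n) + 2 * t * (b (X n) y - l y) + t\<^sup>2 * b y y"
          by (simp add: J_def lin lin2 L.add L.scaleR sym[of y "X n"] algebra_simps power2_eq_square)
        with m_le[of "X n + t *\<^sub>R y"] X[of n] show ?thesis by linarith
      qed
      then show "\<exists>N. \<forall>n\<ge>N. 0 \<le> 1 / real (Suc n) + 2 * t * (b (X n) y - l y) + t\<^sup>2 * b y y"
        by blast
    qed
    define \<beta> where "\<beta> = b y y"
    have \<beta>: "\<beta> \<ge> 0" using coercive[of y] c by (simp add: \<beta>_def order_trans[rotated])
    \<comment> \<open>\<open>- r\<close> minimises the quadratic in \<open>t\<close> after
      \<open>\<beta>\<close> is enlarged by 1, which keeps the denominator positive when
      \<open>\<beta> = 0\<close>.\<close>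
    define r where "r = d / (\<beta> + 1)"
    have d: "d = r * (\<beta> + 1)" using \<beta> by (simp add: r_def)
    have "0 \<le> 2 * (- r) * d + (- r)\<^sup>2 * \<beta>"
      using ge0[of "- r"] by (simp only: \<beta>_def)
    also have "\<dots> = - (r\<^sup>2 * (\<beta> + 2))" by (simp add: d algebra_simps power2_eq_square)
    finally have "r\<^sup>2 * (\<beta> + 2) \<le> 0" by simp
    with \<beta> have "r = 0" by (simp add: mult_le_0_iff)
    with d have "d = 0" by simp
    then show ?thesis by (simp add: d_def)
  qed
  then show ?thesis by blast
qed

text \<open>\<open>inv\<close> gives a true preimage only on the range, so the point is that
  \<open>riesz\<close> is onto: this is the previous lemma with the inner product as
  \<open>b\<close>.\<close>

lemma inner_inv_riesz:
  fixes f :: "'a::{real_inner,complete_space} \<Rightarrow>\<^sub>L real"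
  shows "inv riesz f \<bullet> x = blinfun_apply f x"
proof -
  have "\<exists>p. \<forall>y. p \<bullet> y = blinfun_apply f y"
    by (rule symmetric_lax_milgram[where c = 1])
       (simp_all add: power2_norm_eq_inner bounded_linear_inner_left blinfun.bounded_linear_right,
        simp add: inner_commute)
  then obtain p where "\<forall>y. p \<bullet> y = blinfun_apply f y" ..
  then have "riesz p = f" unfolding riesz_def by (intro blinfun_eqI) (simp add: inner_commute)
  then have "riesz (inv riesz f) = f" by (metis f_inv_into_f rangeI)
  then have "blinfun_apply (riesz (inv riesz f)) x = blinfun_apply f x" by simp
  then show ?thesis by (simp add: riesz_def inner_commute)
qed

section \<open>Weak integrals and strong measurability\<close>

lemma has_weak_integral_unique:
  assumes "has_weak_integral N f x" "has_weak_integral N f x'"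
  shows "x = x'"
proof -
  have "x \<bullet> y = x' \<bullet> y" for y
    using assms unfolding has_weak_integral_def by (metis has_bochner_integral_eq)
  then show ?thesis by (metis vector_eq_rdot)
qed

lemma has_weak_integral_weak_integral:
  assumes "\<exists>x. has_weak_integral N f x"
  shows "has_weak_integral N f (weak_integral N f)"
  using assms has_weak_integral_unique unfolding weak_integral_def by (metis theI)

text \<open>For a simple function in place of \<open>f\<close>, the composite is patched from
  finitely many sections \<open>\<lambda>w. F w x\<close>, which are measurable; continuity in
  \<open>x\<close> then passes to the limit. Measurability of \<open>F\<close> is asked for only at
  fixed \<open>x\<close>.\<close>

lemma borel_measurable_caratheodory:
  fixes F :: "'a \<Rightarrow> 'b::real_normed_vector \<Rightarrow> 'c::metric_space"
  assumes s: "strongly_measurable N f"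
    and meas: "\<And>x. (\<lambda>w. F w x) \<in> borel_measurable N"
    and cont: "\<And>w. w \<in> space N \<Longrightarrow> continuous_on UNIV (F w)"
  shows "(\<lambda>w. F w (f w)) \<in> borel_measurable N"
proof -
  obtain s where s: "\<And>i. simple_function N (s i)"
    and lim: "\<And>w. w \<in> space N \<Longrightarrow> (\<lambda>i. s i w) \<longlonglongrightarrow> f w"
    using s unfolding strongly_measurable_def by (metis (full_types))
  show ?thesis
  proof (rule borel_measurable_LIMSEQ_metric)
    show "(\<lambda>w. F w (s i w)) \<in> borel_measurable N" for i
      by (rule measurable_compose_countable'[where I = "s i ` space N", OF meas])
         (use s[of i] in \<open>auto simp: simple_function_def countable_finite measurable_count_space_eq_countable\<close>)
    show "(\<lambda>i. F w (s i w)) \<longlonglongrightarrow> F w (f w)" if "w \<in> space N" for w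
      using cont[OF that] lim[OF that] by (rule continuous_on_tendsto_compose) auto
  qed
qed

lemma strongly_measurable_borel_measurable:
  "strongly_measurable N f \<Longrightarrow> f \<in> borel_measurable N"
  using borel_measurable_caratheodory[of N f "\<lambda>_ x. x"] by auto

text \<open>The union of the finite ranges of the approximating simple functions is countable, and
  each value of \<open>f\<close> is a limit of its points.\<close>

lemma strongly_measurable_countable:
  assumes "strongly_measurable N f"
  shows "\<exists>D. countable D \<and> (\<forall>w\<in>space N. f w \<in> closure D)"
proof -
  obtain s where s: "\<And>i::nat. simple_function N (s i)"
    and lim: "\<And>w. w \<in> space N \<Longrightarrow> (\<lambda>i. s i w) \<longlonglongrightarrow> f w"
    using assms unfolding strongly_measurable_def by (metis (full_types))
  have "countable (\<Union>i. s i ` space N)"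
    by (rule countable_UN[OF _ countable_finite[OF simple_functionD(1)[OF s]]]) auto
  moreover have "f w \<in> closure (\<Union>i. s i ` space N)" if "w \<in> space N" for w
    using lim[OF that] that by (auto simp: closure_sequential intro!: exI[of _ "\<lambda>i. s i w"])
  ultimately show ?thesis by blast
qed

text \<open>The codomain need not be separable, so the library's approximation by simple functions
  does not apply; separability of the range takes its place.\<close>

lemma strongly_measurableI:
  assumes f: "f \<in> borel_measurable N" and D: "countable D"
    and cl: "\<And>w. w \<in> space N \<Longrightarrow> f w \<in> closure D"
  shows "strongly_measurable N f"
proof (cases "D = {}")
  case True
  then have "space N = {}" using cl by auto
  then show ?thesis unfolding strongly_measurable_def by (auto simp: simple_function_def)
next
  case False
  define d where "d = from_nat_into D"
  have range_d: "range d = D" unfolding d_def using D False by (simp add: range_from_nat_into)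
  have [measurable]: "(\<lambda>w. dist (f w) x) \<in> borel_measurable N" for x
    by (rule borel_measurable_continuous_on[OF _ f]) (intro continuous_intros)
  \<comment> \<open>\<open>s n w\<close> is the first of \<open>d 0, \<dots>, d n\<close> that is closest to \<open>f w\<close>, at distance \<open>e n w\<close>.\<close>
  define e where "e = rec_nat (\<lambda>w. dist (f w) (d 0)) (\<lambda>n e w. min (dist (f w) (d (Suc n))) (e w))"
  have e_simps: "e 0 w = dist (f w) (d 0)" "e (Suc n) w = min (dist (f w) (d (Suc n))) (e n w)" for n w
    by (simp_all add: e_def)
  have e_meas[measurable]: "e n \<in> borel_measurable N" for n
  proof (induction n)
    case 0
    show ?case unfolding e_simps(1)[abs_def] by measurable
  next
    case (Suc n)
    note Suc[measurable]
    have "e (Suc n) = (\<lambda>w. min (dist (f w) (d (Suc n))) (e n w))" by (simp add: e_simps fun_eq_iff)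
    then show ?case by simp
  qed
  define s where "s = rec_nat (\<lambda>w. d 0) (\<lambda>n s w. if dist (f w) (d (Suc n)) < e n w then d (Suc n) else s w)"
  have s_simps: "s 0 = (\<lambda>w. d 0)"
    "s (Suc n) = (\<lambda>w. if dist (f w) (d (Suc n)) < e n w then d (Suc n) else s n w)" for n
    unfolding s_def by simp_all
  have s: "simple_function N (s n)" for n
    by (induction n) (auto simp: s_simps intro!: simple_function_If)
  have s_dist: "dist (f w) (s n w) = e n w" for n w
    by (induction n) (auto simp: s_simps e_simps)
  have e_le: "e n w \<le> dist (f w) (d i)" if "i \<le> n" for n i w
    using that by (induction n) (auto simp: e_simps le_Suc_eq)
  have "(\<lambda>n. s n w) \<longlonglongrightarrow> f w" if w: "w \<in> space N" for w
  proof (rule metric_LIMSEQ_I)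
    fix r :: real assume "r > 0"
    then obtain y where "y \<in> D" "dist y (f w) < r"
      using cl[OF w] unfolding closure_approachable by blast
    then obtain i where i: "dist (d i) (f w) < r" using range_d by blast
    have "dist (s n w) (f w) < r" if "n \<ge> i" for n
      using e_le[OF that, of w] i s_dist[of w n] by (simp add: dist_commute)
    then show "\<exists>n0. \<forall>n\<ge>n0. dist (s n w) (f w) < r" by blast
  qed
  with s show ?thesis unfolding strongly_measurable_def by blast
qed

text \<open>Borel measurability is already known, so only separability of the range remains. The
  countable sets \<open>E x\<close> of the sections, joined over \<open>x\<close> in a countable set
  \<open>D\<close> that approximates \<open>f\<close>, work because continuity maps
  \<open>closure D\<close> into the closure of the union.\<close>

lemma strongly_measurable_caratheodory:
  fixes F :: "'a \<Rightarrow> 'b::real_normed_vector \<Rightarrow> 'c::real_normed_vector"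
  assumes s: "strongly_measurable N f"
    and meas: "\<And>x. strongly_measurable N (\<lambda>w. F w x)"
    and cont: "\<And>w. w \<in> space N \<Longrightarrow> continuous_on UNIV (F w)"
  shows "strongly_measurable N (\<lambda>w. F w (f w))"
proof -
  obtain D where D: "countable D" "\<And>w. w \<in> space N \<Longrightarrow> f w \<in> closure D"
    using strongly_measurable_countable[OF s] by blast
  obtain E where E: "\<And>x. countable (E x)" "\<And>x w. w \<in> space N \<Longrightarrow> F w x \<in> closure (E x)"
    using strongly_measurable_countable[OF meas] by metis
  show ?thesis
  proof (rule strongly_measurableI)
    show "(\<lambda>w. F w (f w)) \<in> borel_measurable N"
      using borel_measurable_caratheodory[OF s strongly_measurable_borel_measurable[OF meas] cont] .
    show "countable (\<Union>x\<in>D. E x)" using D E by auto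
    fix w assume w: "w \<in> space N"
    have "F w ` closure D \<subseteq> closure (\<Union>x\<in>D. E x)"
    proof (rule image_closure_subset)
      show "continuous_on (closure D) (F w)" using cont[OF w] continuous_on_subset by blast
      show "F w ` D \<subseteq> closure (\<Union>x\<in>D. E x)"
        using E(2)[OF w] closure_mono[of "E _" "\<Union>x\<in>D. E x"] by blast
    qed simp
    then show "F w (f w) \<in> closure (\<Union>x\<in>D. E x)" using D(2)[OF w] by blast
  qed
qed

section \<open>Cauchy-Schwarz and Fubini for integrals of random functions\<close>

text \<open>The pointwise hypothesis \<open>le\<close> lets one lemma serve both the inner product
  and the form of \<open>Q t\<close>.\<close>

lemma Cauchy_Schwarz_nn_integral_sqrt:
  fixes f g h :: "'a \<Rightarrow> real"
  assumes [measurable]: "g \<in> borel_measurable N" "h \<in> borel_measurable N"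
    and nonneg: "\<And>x. x \<in> space N \<Longrightarrow> 0 \<le> g x" "\<And>x. x \<in> space N \<Longrightarrow> 0 \<le> h x"
    and le: "\<And>x. x \<in> space N \<Longrightarrow> (f x)\<^sup>2 \<le> g x * h x"
  shows "(\<integral>\<^sup>+x. ennreal \<bar>f x\<bar> \<partial>N)\<^sup>2 \<le> (\<integral>\<^sup>+x. ennreal (g x) \<partial>N) * (\<integral>\<^sup>+x. ennreal (h x) \<partial>N)"
proof -
  have "(\<integral>\<^sup>+x. ennreal \<bar>f x\<bar> \<partial>N) \<le> (\<integral>\<^sup>+x. ennreal (sqrt (g x)) * ennreal (sqrt (h x)) \<partial>N)"
  proof (rule nn_integral_mono)
    fix x assume x: "x \<in> space N"
    have "\<bar>f x\<bar> \<le> sqrt (g x * h x)"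
      using le[OF x] by (metis real_sqrt_abs real_sqrt_le_mono)
    then show "ennreal \<bar>f x\<bar> \<le> ennreal (sqrt (g x)) * ennreal (sqrt (h x))"
      using nonneg[OF x] by (simp add: real_sqrt_mult flip: ennreal_mult)
  qed
  then have "(\<integral>\<^sup>+x. ennreal \<bar>f x\<bar> \<partial>N)\<^sup>2 \<le> (\<integral>\<^sup>+x. ennreal (sqrt (g x)) * ennreal (sqrt (h x)) \<partial>N)\<^sup>2"
    by (rule power_mono_ennreal)
  also have "\<dots> \<le> (\<integral>\<^sup>+x. (ennreal (sqrt (g x)))\<^sup>2 \<partial>N) * (\<integral>\<^sup>+x. (ennreal (sqrt (h x)))\<^sup>2 \<partial>N)"
    by (rule Cauchy_Schwarz_nn_integral) measurable
  also have "(\<integral>\<^sup>+x. (ennreal (sqrt (g x)))\<^sup>2 \<partial>N) = (\<integral>\<^sup>+x. ennreal (g x) \<partial>N)"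
    by (rule nn_integral_cong) (simp add: ennreal_power nonneg)
  also have "(\<integral>\<^sup>+x. (ennreal (sqrt (h x)))\<^sup>2 \<partial>N) = (\<integral>\<^sup>+x. ennreal (h x) \<partial>N)"
    by (rule nn_integral_cong) (simp add: ennreal_power nonneg)
  finally show ?thesis .
qed

lemma ennreal_power2_less_top_imp: "(x::ennreal)\<^sup>2 < \<infinity> \<Longrightarrow> x < \<infinity>"
  by (cases x) (auto simp: power2_eq_square)

text \<open>If \<open>f\<close> is not integrable, its integral is 0 by convention, so the bound
  holds for every sample path, including exceptional ones.\<close>

lemma abs_integral_le_nn_integral:
  "ennreal \<bar>\<integral>x. f x \<partial>N\<bar> \<le> (\<integral>\<^sup>+x. ennreal \<bar>f x\<bar> \<partial>N)" for f :: "'a \<Rightarrow> real"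
proof (cases "integrable N f")
  case True
  then show ?thesis using integral_norm_bound_ennreal[of N f] by simp
next
  case False
  then show ?thesis by (simp add: not_integrable_integral_eq)
qed

text \<open>Writing one factor of the squared integral as a constant and moving it inside reduces
  the formula to two applications of Fubini. The innermost integral on the right is the correlation
  of \<open>F x\<close> and \<open>F x'\<close>, so the second moment is determined by correlations
  alone.\<close>

lemma (in pair_sigma_finite)
  fixes F :: "'a \<Rightarrow> 'b \<Rightarrow> real"
  assumes F[measurable]: "case_prod F \<in> borel_measurable (M1 \<Otimes>\<^sub>M M2)"
    and fin: "(\<integral>\<^sup>+y. (\<integral>\<^sup>+x. ennreal \<bar>F x y\<bar> \<partial>M1)\<^sup>2 \<partial>M2) < \<infinity>"
    and sq: "\<And>x. x \<in> space M1 \<Longrightarrow> integrable M2 (\<lambda>y. (F x y)\<^sup>2)"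
  shows second_moment_integral:
      "(\<integral>y. (\<integral>x. F x y \<partial>M1)\<^sup>2 \<partial>M2) = (\<integral>x. (\<integral>x'. (\<integral>y. F x y * F x' y \<partial>M2) \<partial>M1) \<partial>M1)"
    and integrable_second_moment: "integrable M2 (\<lambda>y. (\<integral>x. F x y \<partial>M1)\<^sup>2)"
    and AE_integrable_second_moment: "AE y in M2. integrable M1 (\<lambda>x. F x y)"
proof -
  define X where "X y = (\<integral>x. F x y \<partial>M1)" for y
  define Y where "Y y = (\<integral>\<^sup>+x. ennreal \<bar>F x y\<bar> \<partial>M1)" for y
  have swp[measurable]: "(\<lambda>(y, x). F x y) \<in> borel_measurable (M2 \<Otimes>\<^sub>M M1)"
    using measurable_pair_swap[OF F] by (simp add: case_prod_beta')
  have X[measurable]: "X \<in> borel_measurable M2"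
    unfolding X_def by (rule M1.borel_measurable_lebesgue_integral) simp
  have Y[measurable]: "Y \<in> borel_measurable M2"
    unfolding Y_def by measurable
  have F1[measurable]: "(\<lambda>y. F x y) \<in> borel_measurable M2" if "x \<in> space M1" for x
    using measurable_Pair2[OF F that] by simp
  have F2: "(\<lambda>x. F x y) \<in> borel_measurable M1" if "y \<in> space M2" for y
    using measurable_Pair1[OF F that] by simp
  have XY: "ennreal \<bar>X y\<bar> \<le> Y y" for y
    unfolding X_def Y_def by (rule abs_integral_le_nn_integral)
  have finY: "(\<integral>\<^sup>+y. (Y y)\<^sup>2 \<partial>M2) < \<infinity>"
    using fin by (simp add: Y_def)
  have "AE y in M2. (Y y)\<^sup>2 \<noteq> \<infinity>"
    using finY by (intro nn_integral_PInf_AE) auto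
  then show "AE y in M2. integrable M1 (\<lambda>x. F x y)"
    using AE_space
  proof eventually_elim
    case (elim y)
    then have "Y y < \<infinity>" using ennreal_power2_less_top_imp[of "Y y"] by (auto simp: top.not_eq_extremum)
    with F2[OF elim(2)] show ?case by (auto simp: integrable_iff_bounded Y_def)
  qed
  \<comment> \<open>This also holds for the exceptional \<open>y\<close> whose path is not
    integrable: there \<open>X y\<close> is 0, and so are both sides.\<close>
  have X2: "(X y)\<^sup>2 = (\<integral>x. F x y * X y \<partial>M1)" for y
    by (simp add: X_def power2_eq_square)
  have int1: "integrable (M1 \<Otimes>\<^sub>M M2) (\<lambda>(x, y). F x y * X y)"
  proof (rule integrableI_bounded)
    have "(\<integral>\<^sup>+ z. ennreal (norm (case z of (x, y) \<Rightarrow> F x y * X y)) \<partial>(M1 \<Otimes>\<^sub>M M2))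
        = (\<integral>\<^sup>+y. (\<integral>\<^sup>+x. ennreal \<bar>F x y * X y\<bar> \<partial>M1) \<partial>M2)"
      by (subst nn_integral_snd[symmetric]) auto
    also have "\<dots> \<le> (\<integral>\<^sup>+y. (Y y)\<^sup>2 \<partial>M2)"
    proof (rule nn_integral_mono)
      fix y assume y: "y \<in> space M2"
      note F2[OF y, measurable]
      have "(\<integral>\<^sup>+x. ennreal \<bar>F x y * X y\<bar> \<partial>M1) = Y y * ennreal \<bar>X y\<bar>"
        by (simp add: abs_mult ennreal_mult nn_integral_multc Y_def)
      then show "(\<integral>\<^sup>+x. ennreal \<bar>F x y * X y\<bar> \<partial>M1) \<le> (Y y)\<^sup>2"
        by (simp add: power2_eq_square mult_left_mono XY)
    qed
    finally show "(\<integral>\<^sup>+ z. ennreal (norm (case z of (x, y) \<Rightarrow> F x y * X y)) \<partial>(M1 \<Otimes>\<^sub>M M2)) < \<infinity>"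
      using finY by (rule le_less_trans)
  qed measurable
  show "integrable M2 (\<lambda>y. (\<integral>x. F x y \<partial>M1)\<^sup>2)"
    using integrable_snd[OF int1] X2 by (simp add: X_def)
  \<comment> \<open>For the second Fubini \<open>x\<close> is frozen. Integrating over
    \<open>x'\<close> first leaves the product of \<open>\<bar>F x y\<bar>\<close> and
    \<open>Y y\<close>, both square integrable in \<open>y\<close>: the first by \<open>sq\<close>,
    the second by \<open>fin\<close>.\<close>
  have int2: "integrable (M1 \<Otimes>\<^sub>M M2) (\<lambda>(x', y). F x y * F x' y)" if x: "x \<in> space M1" for x
  proof (rule integrableI_bounded)
    note F1[OF x, measurable]
    have "(\<integral>\<^sup>+ z. ennreal (norm (case z of (x', y) \<Rightarrow> F x y * F x' y)) \<partial>(M1 \<Otimes>\<^sub>M M2))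
        = (\<integral>\<^sup>+y. (\<integral>\<^sup>+x'. ennreal \<bar>F x y * F x' y\<bar> \<partial>M1) \<partial>M2)"
      by (subst nn_integral_snd[symmetric]) auto
    also have "\<dots> = (\<integral>\<^sup>+y. ennreal \<bar>F x y\<bar> * Y y \<partial>M2)"
    proof (rule nn_integral_cong)
      fix y assume y: "y \<in> space M2"
      note F2[OF y, measurable]
      show "(\<integral>\<^sup>+x'. ennreal \<bar>F x y * F x' y\<bar> \<partial>M1) = ennreal \<bar>F x y\<bar> * Y y"
        by (simp add: abs_mult ennreal_mult nn_integral_cmult Y_def)
    qed
    also have "\<dots> < \<infinity>"
    proof (rule ennreal_power2_less_top_imp)
      have "(\<integral>\<^sup>+y. ennreal \<bar>F x y\<bar> * Y y \<partial>M2)\<^sup>2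
          \<le> (\<integral>\<^sup>+y. (ennreal \<bar>F x y\<bar>)\<^sup>2 \<partial>M2) * (\<integral>\<^sup>+y. (Y y)\<^sup>2 \<partial>M2)"
        by (rule Cauchy_Schwarz_nn_integral) measurable
      also have "\<dots> < \<infinity>"
        using finY sq[OF x] by (auto simp: integrable_iff_bounded ennreal_power ennreal_mult_less_top)
      finally show "(\<integral>\<^sup>+y. ennreal \<bar>F x y\<bar> * Y y \<partial>M2)\<^sup>2 < \<infinity>" .
    qed
    finally show "(\<integral>\<^sup>+ z. ennreal (norm (case z of (x', y) \<Rightarrow> F x y * F x' y)) \<partial>(M1 \<Otimes>\<^sub>M M2)) < \<infinity>" .
  qed (use F1[OF x] in measurable)
  have "(\<integral>y. (X y)\<^sup>2 \<partial>M2) = (\<integral>y. (\<integral>x. F x y * X y \<partial>M1) \<partial>M2)" by (simp add: X2)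
  also have "\<dots> = (\<integral>x. (\<integral>y. F x y * X y \<partial>M2) \<partial>M1)"
    using integral_snd[OF int1] integral_fst[OF int1] by simp
  also have "\<dots> = (\<integral>x. (\<integral>x'. (\<integral>y. F x y * F x' y \<partial>M2) \<partial>M1) \<partial>M1)"
  proof (rule Bochner_Integration.integral_cong[OF refl])
    fix x assume x: "x \<in> space M1"
    have "(\<integral>y. F x y * X y \<partial>M2) = (\<integral>y. (\<integral>x'. F x y * F x' y \<partial>M1) \<partial>M2)" by (simp add: X_def)
    also have "\<dots> = (\<integral>x'. (\<integral>y. F x y * F x' y \<partial>M2) \<partial>M1)"
      using integral_snd[OF int2[OF x]] integral_fst[OF int2[OF x]] by simp
    finally show "(\<integral>y. F x y * X y \<partial>M2) = (\<integral>x'. (\<integral>y. F x y * F x' y \<partial>M2) \<partial>M1)" .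
  qed
  finally show "(\<integral>y. (\<integral>x. F x y \<partial>M1)\<^sup>2 \<partial>M2) = (\<integral>x. (\<integral>x'. (\<integral>y. F x y * F x' y \<partial>M2) \<partial>M1) \<partial>M1)"
    by (simp add: X_def)
qed

text \<open>The form is nonnegative at \<open>x - (d / \<beta>) *\<^sub>R y\<close>, the point of
  the line through \<open>x\<close> in direction \<open>y\<close> where it is smallest. Coercivity
  makes \<open>\<beta>\<close> positive for \<open>y \<noteq> 0\<close>.\<close>

lemma coercive_Cauchy_Schwarz:
  fixes A :: "'a::real_inner \<Rightarrow>\<^sub>L 'a"
  assumes sym: "\<And>x y. blinfun_apply A x \<bullet> y = x \<bullet> blinfun_apply A y"
    and lower: "\<And>x. c * (x \<bullet> x) \<le> blinfun_apply A x \<bullet> x" and c: "c > 0"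
  shows "(blinfun_apply A x \<bullet> y)\<^sup>2 \<le> (blinfun_apply A x \<bullet> x) * (blinfun_apply A y \<bullet> y)"
proof (cases "y = 0")
  case False
  define \<beta> where "\<beta> = blinfun_apply A y \<bullet> y"
  define d where "d = blinfun_apply A x \<bullet> y"
  have nonneg: "0 \<le> blinfun_apply A z \<bullet> z" for z
    using lower[of z] c by (meson inner_ge_zero mult_nonneg_nonneg order_less_imp_le order_trans)
  have \<beta>: "\<beta> > 0"
    using lower[of y] c False unfolding \<beta>_def
    by (meson inner_gt_zero_iff less_le_trans mult_pos_pos)
  have "blinfun_apply A y \<bullet> x = d" unfolding d_def by (metis sym inner_commute)
  then have "blinfun_apply A (x - (d / \<beta>) *\<^sub>R y) \<bullet> (x - (d / \<beta>) *\<^sub>R y)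
      = blinfun_apply A x \<bullet> x - 2 * (d / \<beta>) * d + (d / \<beta>)\<^sup>2 * \<beta>"
    by (simp add: blinfun.diff_right blinfun.scaleR_right inner_diff_left inner_diff_right
        d_def \<beta>_def power2_eq_square)
  also have "\<dots> = blinfun_apply A x \<bullet> x - d\<^sup>2 / \<beta>"
    using \<beta> by (simp add: power2_eq_square)
  finally have "d\<^sup>2 / \<beta> \<le> blinfun_apply A x \<bullet> x"
    using nonneg[of "x - (d / \<beta>) *\<^sub>R y"] by simp
  with \<beta> show ?thesis by (simp add: d_def \<beta>_def pos_divide_le_eq)
qed simp

lemma inner_gram_integrand:
  fixes C :: "real \<Rightarrow> 'h::{real_inner,complete_space} \<Rightarrow>\<^sub>L 'k::real_inner"
  shows "gram_integrand C Q \<psi> t \<bullet> y = blinfun_apply (Q t) (blinfun_apply (C t) \<psi>) \<bullet> blinfun_apply (C t) y"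
  unfolding gram_integrand_def inner_inv_riesz by (simp add: dual_adjoint_def riesz_def inner_commute)

section \<open>Second moments of linear functionals of the noise\<close>

lemma pair_sigma_finite_lebesgue_on:
  assumes "prob_space M"
  shows "pair_sigma_finite (lebesgue_on {0..T::real}) M"
proof -
  interpret prob_space M by fact
  interpret L: finite_measure "lebesgue_on {0..T}"
    by (rule finite_measure_lebesgue_on) simp
  show ?thesis ..
qed

lemma noise_norm_sq_measurable:
  assumes "noise_process M T \<eta>"
  shows "(\<lambda>(t, \<omega>). (norm (\<eta> t \<omega>))\<^sup>2) \<in> borel_measurable (lebesgue_on {0..T} \<Otimes>\<^sub>M M)"
  using assms borel_measurable_caratheodory[of "lebesgue_on {0..T} \<Otimes>\<^sub>M M" "case_prod \<eta>" "\<lambda>_ x. (norm x)\<^sup>2"]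
  by (auto simp: noise_process_def case_prod_beta' intro!: continuous_intros)

text \<open>Since the values may lie in a nonseparable space, joint measurability is drawn from the
  Caratheodory lemma on the product space, with \<open>\<eta>\<close> inserted into the continuous
  functional \<open>x \<bullet> u t\<close>.\<close>

lemma noise_inner_measurable:
  assumes \<eta>: "noise_process M T \<eta>" and u: "strongly_measurable (lebesgue_on {0..T}) u"
  shows "(\<lambda>(t, \<omega>). u t \<bullet> \<eta> t \<omega>) \<in> borel_measurable (lebesgue_on {0..T} \<Otimes>\<^sub>M M)"
proof -
  have "(\<lambda>t. u t \<bullet> x) \<in> borel_measurable (lebesgue_on {0..T})" for x
    by (rule borel_measurable_continuous_on[OF _ strongly_measurable_borel_measurable[OF u]])
       (intro continuous_intros)
  then have "(\<lambda>z. u (fst z) \<bullet> x) \<in> borel_measurable (lebesgue_on {0..T} \<Otimes>\<^sub>M M)" for x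
    by (rule measurable_compose[OF measurable_fst])
  then have "(\<lambda>z. u (fst z) \<bullet> case_prod \<eta> z) \<in> borel_measurable (lebesgue_on {0..T} \<Otimes>\<^sub>M M)"
    using \<eta> by (intro borel_measurable_caratheodory[where F = "\<lambda>z x. u (fst z) \<bullet> x" and f = "case_prod \<eta>"]) (auto simp: noise_process_def intro!: continuous_intros)
  then show ?thesis by (simp add: case_prod_beta')
qed

text \<open>This is the second moment formula for
  \<open>F t \<omega> = u t \<bullet> \<eta> t \<omega>\<close>, with the inner expectation replaced
  by the correlation operator. Two noises with the same \<open>R\<close> therefore give the same
  second moment.\<close>

lemma noise_functional:
  assumes prob: "prob_space M" and \<eta>: "noise_process M T \<eta>"
    and R: "is_correlation_op M T \<eta> R" and u: "u \<in> L2_on T"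
  shows noise_functional_second_moment:
      "(\<integral>\<omega>. (\<integral>t. u t \<bullet> \<eta> t \<omega> \<partial>lebesgue_on {0..T})\<^sup>2 \<partial>M)
        = (\<integral>t. (\<integral>s. blinfun_apply (R t s) (u t) \<bullet> u s \<partial>lebesgue_on {0..T}) \<partial>lebesgue_on {0..T})"
    and integrable_noise_functional_sq:
      "integrable M (\<lambda>\<omega>. (\<integral>t. u t \<bullet> \<eta> t \<omega> \<partial>lebesgue_on {0..T})\<^sup>2)"
    and AE_integrable_noise_functional:
      "AE \<omega> in M. integrable (lebesgue_on {0..T}) (\<lambda>t. u t \<bullet> \<eta> t \<omega>)"
proof -
  define L where "L = lebesgue_on {0..T}"
  interpret pair_sigma_finite L M
    unfolding L_def by (rule pair_sigma_finite_lebesgue_on[OF prob])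
  have space_L: "space L = {0..T}" by (simp add: L_def)
  have u_sm: "strongly_measurable L u" and u_fin: "(\<integral>\<^sup>+t. ennreal ((norm (u t))\<^sup>2) \<partial>L) < \<infinity>"
    using u by (auto simp: L2_on_def L_def)
  have meas: "(\<lambda>(t, \<omega>). u t \<bullet> \<eta> t \<omega>) \<in> borel_measurable (L \<Otimes>\<^sub>M M)"
    using noise_inner_measurable[OF \<eta>] u_sm by (simp add: L_def)
  have u_meas[measurable]: "u \<in> borel_measurable L"
    by (rule strongly_measurable_borel_measurable[OF u_sm])
  have n_meas[measurable]: "(\<lambda>(t, \<omega>). (norm (\<eta> t \<omega>))\<^sup>2) \<in> borel_measurable (L \<Otimes>\<^sub>M M)"
    using noise_norm_sq_measurable[OF \<eta>] by (simp add: L_def)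
  have n_swp[measurable]: "(\<lambda>(\<omega>, t). (norm (\<eta> t \<omega>))\<^sup>2) \<in> borel_measurable (M \<Otimes>\<^sub>M L)"
    using measurable_pair_swap[OF n_meas] by (simp add: case_prod_beta')
  have fin: "(\<integral>\<^sup>+\<omega>. (\<integral>\<^sup>+t. ennreal \<bar>u t \<bullet> \<eta> t \<omega>\<bar> \<partial>L)\<^sup>2 \<partial>M) < \<infinity>"
  proof -
    have "(\<integral>\<^sup>+\<omega>. (\<integral>\<^sup>+t. ennreal \<bar>u t \<bullet> \<eta> t \<omega>\<bar> \<partial>L)\<^sup>2 \<partial>M)
        \<le> (\<integral>\<^sup>+\<omega>. (\<integral>\<^sup>+t. ennreal ((norm (u t))\<^sup>2) \<partial>L) * (\<integral>\<^sup>+t. ennreal ((norm (\<eta> t \<omega>))\<^sup>2) \<partial>L) \<partial>M)"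
    proof (intro nn_integral_mono Cauchy_Schwarz_nn_integral_sqrt)
      fix \<omega> assume "\<omega> \<in> space M"
      then show "(\<lambda>t. (norm (\<eta> t \<omega>))\<^sup>2) \<in> borel_measurable L"
        using measurable_Pair1[OF n_meas] by simp
      show "(u t \<bullet> \<eta> t \<omega>)\<^sup>2 \<le> (norm (u t))\<^sup>2 * (norm (\<eta> t \<omega>))\<^sup>2" for t
        using Cauchy_Schwarz_ineq[of "u t" "\<eta> t \<omega>"] by (simp add: power2_norm_eq_inner)
    qed auto
    also have "\<dots> = (\<integral>\<^sup>+t. ennreal ((norm (u t))\<^sup>2) \<partial>L)
        * (\<integral>\<^sup>+\<omega>. (\<integral>\<^sup>+t. ennreal ((norm (\<eta> t \<omega>))\<^sup>2) \<partial>L) \<partial>M)"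
      by (rule nn_integral_cmult) measurable
    also have "(\<integral>\<^sup>+\<omega>. (\<integral>\<^sup>+t. ennreal ((norm (\<eta> t \<omega>))\<^sup>2) \<partial>L) \<partial>M)
        = (\<integral>\<^sup>+t. (\<integral>\<^sup>+\<omega>. ennreal ((norm (\<eta> t \<omega>))\<^sup>2) \<partial>M) \<partial>L)"
      by (rule Fubini') measurable
    also have "(\<integral>\<^sup>+t. ennreal ((norm (u t))\<^sup>2) \<partial>L) * \<dots> < \<infinity>"
      using \<eta> u_fin by (auto simp: noise_process_def L_def ennreal_mult_less_top)
    finally show ?thesis .
  qed
  \<comment> \<open>The definition of the correlation operator includes integrability of the
    products at every pair of times; here both times are \<open>t\<close> and both vectors are
    \<open>u t\<close>, so no null set of times is lost.\<close>
  have sq: "integrable M (\<lambda>\<omega>. (u t \<bullet> \<eta> t \<omega>)\<^sup>2)" if "t \<in> space L" for t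
    using R that unfolding is_correlation_op_def space_L by (simp add: power2_eq_square inner_commute)
  have corr: "(\<integral>\<omega>. (u t \<bullet> \<eta> t \<omega>) * (u s \<bullet> \<eta> s \<omega>) \<partial>M) = blinfun_apply (R t s) (u t) \<bullet> u s"
    if "t \<in> space L" "s \<in> space L" for t s
    using R that unfolding is_correlation_op_def space_L by (simp add: inner_commute)
  have "(\<integral>\<omega>. (\<integral>t. u t \<bullet> \<eta> t \<omega> \<partial>L)\<^sup>2 \<partial>M)
      = (\<integral>t. (\<integral>s. (\<integral>\<omega>. (u t \<bullet> \<eta> t \<omega>) * (u s \<bullet> \<eta> s \<omega>) \<partial>M) \<partial>L) \<partial>L)"
    using meas fin sq by (rule second_moment_integral)
  also have "\<dots> = (\<integral>t. (\<integral>s. blinfun_apply (R t s) (u t) \<bullet> u s \<partial>L) \<partial>L)"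
    by (intro Bochner_Integration.integral_cong refl corr)
  finally show "(\<integral>\<omega>. (\<integral>t. u t \<bullet> \<eta> t \<omega> \<partial>lebesgue_on {0..T})\<^sup>2 \<partial>M)
        = (\<integral>t. (\<integral>s. blinfun_apply (R t s) (u t) \<bullet> u s \<partial>lebesgue_on {0..T}) \<partial>lebesgue_on {0..T})"
    by (simp add: L_def)
  show "integrable M (\<lambda>\<omega>. (\<integral>t. u t \<bullet> \<eta> t \<omega> \<partial>lebesgue_on {0..T})\<^sup>2)"
    unfolding L_def[symmetric] using meas fin sq by (rule integrable_second_moment)
  show "AE \<omega> in M. integrable (lebesgue_on {0..T}) (\<lambda>t. u t \<bullet> \<eta> t \<omega>)"
    unfolding L_def[symmetric] using meas fin sq by (rule AE_integrable_second_moment)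
qed

text \<open>On each path, Cauchy-Schwarz is applied first to the form of \<open>Q t\<close> and then
  to the time integral. The factor containing \<open>w\<close> is deterministic and leaves the
  expectation; Tonelli puts the other into the order used in \<open>correlation_set\<close>.\<close>

lemma noise_functional_bound:
  fixes Q :: "real \<Rightarrow> 'k::real_inner \<Rightarrow>\<^sub>L 'k"
  assumes prob: "prob_space M" and \<eta>: "noise_process M T \<eta>"
    and w: "strongly_measurable (lebesgue_on {0..T}) w"
    and Q_meas: "\<And>x. strongly_measurable (lebesgue_on {0..T}) (\<lambda>t. blinfun_apply (Q t) x)"
    and sym: "\<And>t x y. t \<in> {0..T} \<Longrightarrow> blinfun_apply (Q t) x \<bullet> y = x \<bullet> blinfun_apply (Q t) y"
    and lower: "\<And>t x. t \<in> {0..T} \<Longrightarrow> c * (x \<bullet> x) \<le> blinfun_apply (Q t) x \<bullet> x" and c: "c > 0"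
  shows "(\<integral>\<^sup>+\<omega>. ennreal ((\<integral>t. blinfun_apply (Q t) (w t) \<bullet> \<eta> t \<omega> \<partial>lebesgue_on {0..T})\<^sup>2) \<partial>M)
      \<le> (\<integral>\<^sup>+t. ennreal (blinfun_apply (Q t) (w t) \<bullet> w t) \<partial>lebesgue_on {0..T})
        * (\<integral>\<^sup>+t. (\<integral>\<^sup>+\<omega>. ennreal (blinfun_apply (Q t) (\<eta> t \<omega>) \<bullet> \<eta> t \<omega>) \<partial>M) \<partial>lebesgue_on {0..T})"
proof -
  define L where "L = lebesgue_on {0..T}"
  interpret pair_sigma_finite L M
    unfolding L_def by (rule pair_sigma_finite_lebesgue_on[OF prob])
  have space_L: "space L = {0..T}" by (simp add: L_def)
  have Qxx: "(\<lambda>t. blinfun_apply (Q t) x \<bullet> x) \<in> borel_measurable L" for x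
    unfolding L_def
    by (rule borel_measurable_continuous_on[OF _ strongly_measurable_borel_measurable[OF Q_meas]])
       (intro continuous_intros)
  have Qww[measurable]: "(\<lambda>t. blinfun_apply (Q t) (w t) \<bullet> w t) \<in> borel_measurable L"
    using w Qxx unfolding L_def[symmetric]
    by (rule borel_measurable_caratheodory[where F = "\<lambda>t x. blinfun_apply (Q t) x \<bullet> x"])
       (intro continuous_intros)
  have "(\<lambda>z. blinfun_apply (Q (fst z)) x \<bullet> x) \<in> borel_measurable (L \<Otimes>\<^sub>M M)" for x
    by (rule measurable_compose[OF measurable_fst Qxx])
  then have "(\<lambda>z. blinfun_apply (Q (fst z)) (case_prod \<eta> z) \<bullet> case_prod \<eta> z) \<in> borel_measurable (L \<Otimes>\<^sub>M M)"
    using \<eta>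
    by (intro borel_measurable_caratheodory[where F = "\<lambda>z x. blinfun_apply (Q (fst z)) x \<bullet> x" and f = "case_prod \<eta>"])
       (auto simp: noise_process_def L_def intro!: continuous_intros)
  then have Qnn[measurable]: "(\<lambda>(t, \<omega>). blinfun_apply (Q t) (\<eta> t \<omega>) \<bullet> \<eta> t \<omega>) \<in> borel_measurable (L \<Otimes>\<^sub>M M)"
    by (simp add: case_prod_beta')
  then have [measurable]: "(\<lambda>(\<omega>, t). blinfun_apply (Q t) (\<eta> t \<omega>) \<bullet> \<eta> t \<omega>) \<in> borel_measurable (M \<Otimes>\<^sub>M L)"
    using measurable_pair_swap[OF Qnn] by (simp add: case_prod_beta')
  have nonneg: "0 \<le> blinfun_apply (Q t) x \<bullet> x" if "t \<in> space L" for t x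
    using lower[of t x] c that unfolding space_L
    by (meson inner_ge_zero mult_nonneg_nonneg order_less_imp_le order_trans)
  have "(\<integral>\<^sup>+\<omega>. ennreal ((\<integral>t. blinfun_apply (Q t) (w t) \<bullet> \<eta> t \<omega> \<partial>L)\<^sup>2) \<partial>M)
      \<le> (\<integral>\<^sup>+\<omega>. (\<integral>\<^sup>+t. ennreal (blinfun_apply (Q t) (w t) \<bullet> w t) \<partial>L)
          * (\<integral>\<^sup>+t. ennreal (blinfun_apply (Q t) (\<eta> t \<omega>) \<bullet> \<eta> t \<omega>) \<partial>L) \<partial>M)"
  proof (rule nn_integral_mono)
    fix \<omega> assume \<omega>: "\<omega> \<in> space M"
    let ?X = "\<integral>t. blinfun_apply (Q t) (w t) \<bullet> \<eta> t \<omega> \<partial>L"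
    have "ennreal (?X\<^sup>2) = (ennreal \<bar>?X\<bar>)\<^sup>2" by (simp add: ennreal_power)
    also have "\<dots> \<le> (\<integral>\<^sup>+t. ennreal \<bar>blinfun_apply (Q t) (w t) \<bullet> \<eta> t \<omega>\<bar> \<partial>L)\<^sup>2"
      by (intro power_mono_ennreal abs_integral_le_nn_integral)
    also have "\<dots> \<le> (\<integral>\<^sup>+t. ennreal (blinfun_apply (Q t) (w t) \<bullet> w t) \<partial>L)
          * (\<integral>\<^sup>+t. ennreal (blinfun_apply (Q t) (\<eta> t \<omega>) \<bullet> \<eta> t \<omega>) \<partial>L)"
    proof (rule Cauchy_Schwarz_nn_integral_sqrt[OF Qww])
      show "(\<lambda>t. blinfun_apply (Q t) (\<eta> t \<omega>) \<bullet> \<eta> t \<omega>) \<in> borel_measurable L"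
        using measurable_Pair1[OF Qnn \<omega>] by simp
      fix t assume t: "t \<in> space L"
      then have t': "t \<in> {0..T}" by (simp add: space_L)
      show "(blinfun_apply (Q t) (w t) \<bullet> \<eta> t \<omega>)\<^sup>2
          \<le> (blinfun_apply (Q t) (w t) \<bullet> w t) * (blinfun_apply (Q t) (\<eta> t \<omega>) \<bullet> \<eta> t \<omega>)"
        by (rule coercive_Cauchy_Schwarz[OF sym[OF t'] lower[OF t'] c])
    qed (use nonneg in auto)
    finally show "ennreal (?X\<^sup>2) \<le> \<dots>" .
  qed
  also have "\<dots> = (\<integral>\<^sup>+t. ennreal (blinfun_apply (Q t) (w t) \<bullet> w t) \<partial>L)
      * (\<integral>\<^sup>+\<omega>. (\<integral>\<^sup>+t. ennreal (blinfun_apply (Q t) (\<eta> t \<omega>) \<bullet> \<eta> t \<omega>) \<partial>L) \<partial>M)"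
    by (rule nn_integral_cmult) measurable
  also have "(\<integral>\<^sup>+\<omega>. (\<integral>\<^sup>+t. ennreal (blinfun_apply (Q t) (\<eta> t \<omega>) \<bullet> \<eta> t \<omega>) \<partial>L) \<partial>M)
      = (\<integral>\<^sup>+t. (\<integral>\<^sup>+\<omega>. ennreal (blinfun_apply (Q t) (\<eta> t \<omega>) \<bullet> \<eta> t \<omega>) \<partial>M) \<partial>L)"
    by (rule Fubini') measurable
  finally show ?thesis by (simp add: L_def)
qed

section \<open>Decay of the minimax mean square error\<close>

theorem proposition4p10:
  fixes M :: "'w measure"
    and j :: "'p::{real_inner,complete_space} \<Rightarrow>\<^sub>L 'h::{real_inner,complete_space}"
    and k :: "'h \<Rightarrow>\<^sub>L 'm::{real_inner,complete_space}"
    and a :: "'p \<Rightarrow> 'p \<Rightarrow> real"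
    and \<gamma> :: "'p \<Rightarrow>\<^sub>L 'd::{real_inner,complete_space}"
    and B0 :: "'f0::{real_inner,complete_space} \<Rightarrow>\<^sub>L ('d \<Rightarrow>\<^sub>L real)"
    and B1 :: "'f1::{real_inner,complete_space} \<Rightarrow>\<^sub>L 'h"
    and C :: "real \<Rightarrow> 'h \<Rightarrow>\<^sub>L 'k::{real_inner,complete_space}"
    and Q :: "real \<Rightarrow> 'k \<Rightarrow>\<^sub>L 'k"
    and \<gamma>T :: "real \<Rightarrow> real"
    and G :: "('f0 \<times> 'f1) set"
    and v :: 'h
  assumes prob: "prob_space M"
    and emb_plus: "inj (blinfun_apply j)"
    and emb_minus: "inj (blinfun_apply k)"
    and form_cont: "bounded_bilinear a"
    and form_coercive: "\<exists>\<alpha>\<noteq>0. \<forall>\<phi>. a \<phi> \<phi> \<ge> \<alpha>\<^sup>2 * (\<phi> \<bullet> \<phi>)"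
    and trace_surj: "surj (blinfun_apply \<gamma>)"
    and ker_dense: "closure (blinfun_apply j ` Hring_plus \<gamma>) = UNIV"
    and Q_selfadjoint: "\<And>t x y. t \<ge> 0 \<Longrightarrow> blinfun_apply (Q t) x \<bullet> y = x \<bullet> blinfun_apply (Q t) y"
    and Q_lower: "\<exists>\<alpha>\<noteq>0. \<forall>t\<ge>0. \<forall>x. blinfun_apply (Q t) x \<bullet> x \<ge> \<alpha>\<^sup>2 * (x \<bullet> x)"
    and Q_norm_cont: "continuous_on {0..} (\<lambda>t. norm (Q t))"
    and Q_measurable:
      "\<And>T x. T > 0 \<Longrightarrow> strongly_measurable (lebesgue_on {0..T}) (\<lambda>t. blinfun_apply (Q t) x)"
    and C_L2: "\<And>T \<psi>. T > 0 \<Longrightarrow> (\<lambda>t. blinfun_apply (C t) \<psi>) \<in> L2_on T"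
    and B_integrable: 
      "\<And>T \<psi>. T > 0 \<Longrightarrow> \<exists>x. has_weak_integral (lebesgue_on {0..T}) (gram_integrand C Q \<psi>) x"
    and \<gamma>T_pos: "\<And>T. T > 0 \<Longrightarrow> \<gamma>T T > 0"
    and G_bounded: "bounded G"
    and lim_B:
      "((\<lambda>T. ereal (inverse ((\<gamma>T T)\<^sup>2)) *
              (INF \<psi>\<in>{\<psi>. norm \<psi> = 1}. ereal (gram_op C Q T \<psi> \<bullet> \<psi>))) \<longlongrightarrow> \<infinity>) at_top"
  shows
    "((\<lambda>T. INF (u, c) \<in> L2_on T \<times> (UNIV :: real set).
             SUP ((f0, f1), \<eta>) \<in> G \<times> admissible_noise M T (correlation_set M T Q (\<gamma>T T)).
               let \<phi> = blinfun_apply j (neumann_state j a \<gamma> B0 B1 f0 f1)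
               in mean_square_error M T v \<phi> (observation C \<phi> \<eta>) u c) \<longlongrightarrow> 0) at_top"
proof -
  obtain \<alpha> where \<alpha>: "\<alpha> \<noteq> 0"
    and lower: "\<And>t x. t \<ge> 0 \<Longrightarrow> \<alpha>\<^sup>2 * (x \<bullet> x) \<le> blinfun_apply (Q t) x \<bullet> x"
    using Q_lower by blast
  have \<alpha>_pos: "\<alpha>\<^sup>2 > 0" using \<alpha> by simp
  let ?risk = "\<lambda>T. INF (u, c) \<in> L2_on T \<times> (UNIV :: real set).
             SUP ((f0, f1), \<eta>) \<in> G \<times> admissible_noise M T (correlation_set M T Q (\<gamma>T T)).
               let \<phi> = blinfun_apply j (neumann_state j a \<gamma> B0 B1 f0 f1)
               in mean_square_error M T v \<phi> (observation C \<phi> \<eta>) u c"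
  \<comment> \<open>This is the quantitative statement at a single \<open>T\<close>, for any
    \<open>K\<close> below the quantity in \<open>lim_B\<close>; at the end \<open>K\<close> is
    fixed by the tolerance.\<close>
  have bound: "?risk T \<le> ennreal ((norm v)\<^sup>2 / K)"
    if T: "T > 0" and K: "K > 0"
      and large: "ereal K < ereal (inverse ((\<gamma>T T)\<^sup>2)) *
              (INF \<psi>\<in>{\<psi>. norm \<psi> = 1}. ereal (gram_op C Q T \<psi> \<bullet> \<psi>))" for T K
  proof -
    define L where "L = lebesgue_on {0..T}"
    define g where "g = (\<gamma>T T)\<^sup>2"
    have g: "g > 0" using \<gamma>T_pos[OF T] by (simp add: g_def)
    \<comment> \<open>\<open>B_integrable\<close> ensures that the description defining
      \<open>weak_integral\<close> denotes an actual integral. Tested against \<open>y\<close>, it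
      becomes the bilinear form that is used from here on.\<close>
    have gram: "has_bochner_integral L
        (\<lambda>t. blinfun_apply (Q t) (blinfun_apply (C t) \<psi>) \<bullet> blinfun_apply (C t) y) (gram_op C Q T \<psi> \<bullet> y)" for \<psi> y
      using has_weak_integral_weak_integral[OF B_integrable[OF T, of \<psi>]]
      unfolding has_weak_integral_def inner_gram_integrand gram_op_def L_def by blast
    have gram_sym: "gram_op C Q T \<psi> \<bullet> y = gram_op C Q T y \<bullet> \<psi>" for \<psi> y
    proof -
      have "has_bochner_integral L
          (\<lambda>t. blinfun_apply (Q t) (blinfun_apply (C t) \<psi>) \<bullet> blinfun_apply (C t) y) (gram_op C Q T y \<bullet> \<psi>)"
      proof (rule has_bochner_integral_cong[OF refl _ refl, THEN iffD1, OF _ gram[of y \<psi>]])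
        fix t assume "t \<in> space L"
        then have "t \<ge> 0" by (simp add: L_def)
        then show "blinfun_apply (Q t) (blinfun_apply (C t) y) \<bullet> blinfun_apply (C t) \<psi>
            = blinfun_apply (Q t) (blinfun_apply (C t) \<psi>) \<bullet> blinfun_apply (C t) y"
          by (metis Q_selfadjoint inner_commute)
      qed
      with gram[of \<psi> y] show ?thesis by (rule has_bochner_integral_eq)
    qed
    \<comment> \<open>Linearity and boundedness come from symmetry: the functional is the inner
      product with the fixed vector \<open>gram_op C Q T y\<close>.\<close>
    have bl: "bounded_linear (\<lambda>\<psi>. gram_op C Q T \<psi> \<bullet> y)" for y
      unfolding gram_sym[of _ y] by (rule bounded_linear_inner_right)
    \<comment> \<open>The hypothesis speaks of unit vectors; scaling out of the first slot again
      goes through symmetry.\<close>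
    have coercive: "K * g * (norm \<psi>)\<^sup>2 \<le> gram_op C Q T \<psi> \<bullet> \<psi>" for \<psi>
    proof (cases "\<psi> = 0")
      case False
      define e where "e = \<psi> /\<^sub>R norm \<psi>"
      have e: "norm e = 1" and \<psi>: "\<psi> = norm \<psi> *\<^sub>R e" using False by (simp_all add: e_def)
      have "ereal K \<le> ereal (inverse g) * ereal (gram_op C Q T e \<bullet> e)"
        using e g by (intro less_imp_le[OF large, folded g_def, THEN order_trans] ereal_mult_left_mono INF_lower) auto
      then have "K * g \<le> gram_op C Q T e \<bullet> e"
        using g by (simp add: field_simps)
      then have "K * g * (norm \<psi>)\<^sup>2 \<le> (gram_op C Q T e \<bullet> e) * (norm \<psi>)\<^sup>2"
        by (rule mult_right_mono) simp
      also have "\<dots> = norm \<psi> * (gram_op C Q T e \<bullet> (norm \<psi> *\<^sub>R e))"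
        by (simp add: power2_eq_square)
      also have "\<dots> = gram_op C Q T (norm \<psi> *\<^sub>R e) \<bullet> (norm \<psi> *\<^sub>R e)"
        by (simp add: gram_sym[of "norm \<psi> *\<^sub>R e" e])
      finally show ?thesis using \<psi> by simp
    qed simp
    have "K * g > 0" using K g by simp
    from symmetric_lax_milgram[OF bl gram_sym coercive this bounded_linear_inner_right[of v]]
    obtain p where p: "\<And>y. gram_op C Q T p \<bullet> y = v \<bullet> y" by blast
    \<comment> \<open>Coercivity at \<open>p\<close> and Cauchy-Schwarz bound \<open>norm p\<close>.
      The factor \<open>1 / g\<close> will cancel the noise bound \<open>g\<close>.\<close>
    have vp: "v \<bullet> p \<le> (norm v)\<^sup>2 / (K * g)"
    proof (cases "p = 0")
      case False
      have "K * g * (norm p)\<^sup>2 \<le> norm v * norm p"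
        using coercive[of p] norm_cauchy_schwarz[of v p] by (simp add: p)
      then have "K * g * norm p \<le> norm v" using False by (simp add: power2_eq_square)
      then have "norm p \<le> norm v / (K * g)" using K g by (simp add: field_simps)
      then have "norm v * norm p \<le> norm v * (norm v / (K * g))" by (rule mult_left_mono) simp
      then show ?thesis
        using norm_cauchy_schwarz[of v p] by (simp add: power2_eq_square)
    qed (use K g in simp)
    define w where "w t = blinfun_apply (C t) p" for t
    define u where "u t = blinfun_apply (Q t) (w t)" for t
    have w: "w \<in> L2_on T" unfolding w_def by (rule C_L2[OF T])
    then have w_sm: "strongly_measurable L w" by (simp add: L2_on_def L_def)
    have Q_meas: "strongly_measurable L (\<lambda>t. blinfun_apply (Q t) x)" for x
      unfolding L_def by (rule Q_measurable[OF T])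
    have u: "u \<in> L2_on T"
    proof -
      have u_sm: "strongly_measurable L u"
        unfolding u_def using w_sm Q_meas
        by (rule strongly_measurable_caratheodory[where F = "\<lambda>t. blinfun_apply (Q t)"]) (intro continuous_intros)
      \<comment> \<open>Continuity of \<open>norm (Q t)\<close> on the compact interval gives a
        uniform bound, which carries square integrability from \<open>w\<close> to
        \<open>u\<close>.\<close>
      obtain q where q: "\<And>t. t \<in> {0..T} \<Longrightarrow> norm (Q t) \<le> q"
      proof -
        have "compact ((\<lambda>t. norm (Q t)) ` {0..T})"
          by (intro compact_continuous_image continuous_on_subset[OF Q_norm_cont]) auto
        then obtain q where "\<forall>x\<in>(\<lambda>t. norm (Q t)) ` {0..T}. norm x \<le> q"
          using compact_imp_bounded bounded_iff by metis
        then show ?thesis by (intro that[of q]) auto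
      qed
      have "(\<integral>\<^sup>+t. ennreal ((norm (u t))\<^sup>2) \<partial>L) \<le> (\<integral>\<^sup>+t. ennreal (q\<^sup>2) * ennreal ((norm (w t))\<^sup>2) \<partial>L)"
      proof (rule nn_integral_mono)
        fix t assume "t \<in> space L"
        then have "norm (u t) \<le> q * norm (w t)"
          using q[of t] norm_blinfun[of "Q t" "w t"] mult_right_mono[of "norm (Q t)" q "norm (w t)"]
          by (simp add: u_def L_def)
        then show "ennreal ((norm (u t))\<^sup>2) \<le> ennreal (q\<^sup>2) * ennreal ((norm (w t))\<^sup>2)"
          by (simp flip: ennreal_mult power_mult_distrib add: power_mono)
      qed
      also have "\<dots> = ennreal (q\<^sup>2) * (\<integral>\<^sup>+t. ennreal ((norm (w t))\<^sup>2) \<partial>L)"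
        using strongly_measurable_borel_measurable[OF w_sm] by (intro nn_integral_cmult) measurable
      also have "\<dots> < \<infinity>" using w by (simp add: L2_on_def L_def ennreal_mult_less_top)
      finally show ?thesis using u_sm by (simp add: L2_on_def L_def)
    qed
    have Qww: "(\<integral>\<^sup>+t. ennreal (u t \<bullet> w t) \<partial>L) = ennreal (v \<bullet> p)"
    proof -
      have "has_bochner_integral L (\<lambda>t. u t \<bullet> w t) (v \<bullet> p)"
        using gram[of p p] by (simp add: p u_def w_def)
      moreover have "AE t in L. 0 \<le> u t \<bullet> w t"
      proof (rule AE_I2)
        fix t assume "t \<in> space L"
        then have "\<alpha>\<^sup>2 * (w t \<bullet> w t) \<le> u t \<bullet> w t" using lower[of t "w t"] by (simp add: L_def u_def)
        then show "0 \<le> u t \<bullet> w t" by (rule order_trans[rotated]) simp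
      qed
      ultimately show ?thesis by (simp add: has_bochner_integral_iff nn_integral_eq_integral)
    qed
    have mse: "mean_square_error M T v \<phi> (observation C \<phi> \<eta>) u 0 \<le> ennreal ((norm v)\<^sup>2 / K)"
      if \<eta>: "\<eta> \<in> admissible_noise M T (correlation_set M T Q (\<gamma>T T))" for \<phi> \<eta>
    proof -
      \<comment> \<open>Membership of \<open>R\<close> in the correlation set states the energy
        bound for some noise \<open>\<eta>'\<close> with that operator, not for
        \<open>\<eta>\<close> itself.\<close>
      obtain R \<eta>' where noise: "noise_process M T \<eta>" and R: "is_correlation_op M T \<eta> R"
        and noise': "noise_process M T \<eta>'" and R': "is_correlation_op M T \<eta>' R"
        and le: "(\<integral>\<^sup>+t. (\<integral>\<^sup>+\<omega>. ennreal (blinfun_apply (Q t) (\<eta>' t \<omega>) \<bullet> \<eta>' t \<omega>) \<partial>M) \<partial>L) \<le> ennreal g"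
        using \<eta> unfolding admissible_noise_def correlation_set_def L_def g_def by blast
      \<comment> \<open>The identity is almost sure because the integral can be split only on paths
        where \<open>u t \<bullet> \<eta> t \<omega>\<close> is integrable. The state drops out by
        \<open>gram[of p \<phi>]\<close> and the choice of \<open>p\<close>.\<close>
      have "AE \<omega> in M. (v \<bullet> \<phi> - (\<integral>t. u t \<bullet> observation C \<phi> \<eta> t \<omega> \<partial>L) - 0)\<^sup>2 = (\<integral>t. u t \<bullet> \<eta> t \<omega> \<partial>L)\<^sup>2"
        using AE_integrable_noise_functional[OF prob noise R u]
      proof eventually_elim
        case (elim \<omega>)
        have "has_bochner_integral L (\<lambda>t. u t \<bullet> blinfun_apply (C t) \<phi> + u t \<bullet> \<eta> t \<omega>)
            (v \<bullet> \<phi> + (\<integral>t. u t \<bullet> \<eta> t \<omega> \<partial>L))"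
          using gram[of p \<phi>] elim
          by (intro has_bochner_integral_add) (simp_all add: p u_def w_def L_def has_bochner_integral_integrable)
        then have "(\<integral>t. u t \<bullet> observation C \<phi> \<eta> t \<omega> \<partial>L) = v \<bullet> \<phi> + (\<integral>t. u t \<bullet> \<eta> t \<omega> \<partial>L)"
          by (simp add: observation_def inner_add_right has_bochner_integral_integral_eq)
        then show ?case by simp
      qed
      then have "mean_square_error M T v \<phi> (observation C \<phi> \<eta>) u 0
          = (\<integral>\<^sup>+\<omega>. ennreal ((\<integral>t. u t \<bullet> \<eta> t \<omega> \<partial>L)\<^sup>2) \<partial>M)"
        unfolding mean_square_error_def L_def[symmetric]
        by (intro nn_integral_cong_AE) auto
      also have "\<dots> = ennreal (\<integral>\<omega>. (\<integral>t. u t \<bullet> \<eta> t \<omega> \<partial>L)\<^sup>2 \<partial>M)"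
        using integrable_noise_functional_sq[OF prob noise R u]
        by (simp add: nn_integral_eq_integral L_def)
      \<comment> \<open>Both moments equal the same double integral of \<open>R\<close>; this is
        where \<open>\<eta>\<close> is exchanged for \<open>\<eta>'\<close>.\<close>
      also have "\<dots> = ennreal (\<integral>\<omega>. (\<integral>t. u t \<bullet> \<eta>' t \<omega> \<partial>L)\<^sup>2 \<partial>M)"
        using noise_functional_second_moment[OF prob noise R u]
          noise_functional_second_moment[OF prob noise' R' u] by (simp add: L_def)
      also have "\<dots> = (\<integral>\<^sup>+\<omega>. ennreal ((\<integral>t. u t \<bullet> \<eta>' t \<omega> \<partial>L)\<^sup>2) \<partial>M)"
        using integrable_noise_functional_sq[OF prob noise' R' u]
        by (simp add: nn_integral_eq_integral L_def)
      also have "\<dots> \<le> (\<integral>\<^sup>+t. ennreal (u t \<bullet> w t) \<partial>L)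
          * (\<integral>\<^sup>+t. (\<integral>\<^sup>+\<omega>. ennreal (blinfun_apply (Q t) (\<eta>' t \<omega>) \<bullet> \<eta>' t \<omega>) \<partial>M) \<partial>L)"
        unfolding u_def L_def
      proof (rule noise_functional_bound[OF prob noise' _ _ _ _ \<alpha>_pos])
        show "strongly_measurable (lebesgue_on {0..T}) w" using w_sm by (simp add: L_def)
      qed (use Q_measurable[OF T] Q_selfadjoint lower in auto)
      also have "(\<integral>\<^sup>+t. ennreal (u t \<bullet> w t) \<partial>L) = ennreal (v \<bullet> p)" by (rule Qww)
      also have "ennreal (v \<bullet> p)
          * (\<integral>\<^sup>+t. (\<integral>\<^sup>+\<omega>. ennreal (blinfun_apply (Q t) (\<eta>' t \<omega>) \<bullet> \<eta>' t \<omega>) \<partial>M) \<partial>L)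
          \<le> ennreal ((norm v)\<^sup>2 / (K * g)) * ennreal g"
        using le vp by (intro mult_mono ennreal_leI) auto
      also have "\<dots> = ennreal ((norm v)\<^sup>2 / K)"
        using K g by (simp flip: ennreal_mult)
      finally show ?thesis .
    qed
    have "?risk T \<le> (SUP ((f0, f1), \<eta>) \<in> G \<times> admissible_noise M T (correlation_set M T Q (\<gamma>T T)).
               let \<phi> = blinfun_apply j (neumann_state j a \<gamma> B0 B1 f0 f1)
               in mean_square_error M T v \<phi> (observation C \<phi> \<eta>) u 0)"
      by (rule INF_lower2[where i = "(u, 0)"]) (use u in auto)
    also have "\<dots> \<le> ennreal ((norm v)\<^sup>2 / K)"
      by (rule SUP_least) (auto simp: Let_def intro: mse)
    finally show ?thesis .
  qed
  show ?thesis
  proof (rule order_tendstoI)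
    fix \<epsilon> :: ennreal assume "0 < \<epsilon>"
    \<comment> \<open>\<open>\<epsilon>\<close> may be infinite, so a finite positive tolerance
      below it is chosen first.\<close>
    then obtain x where x: "0 < x" "x < \<epsilon>" using dense by blast
    define r where "r = enn2real x"
    have "x < \<top>" using x(2) by (simp add: less_le_trans[OF _ top_greatest])
    with x have r: "0 < r" "ennreal r < \<epsilon>" by (simp_all add: r_def enn2real_positive_iff)
    \<comment> \<open>The added 1 keeps \<open>K\<close> positive when \<open>v = 0\<close>.\<close>
    define K where "K = ((norm v)\<^sup>2 + 1) / r"
    have K: "K > 0" using r by (simp add: K_def add_nonneg_pos)
    have "(norm v)\<^sup>2 / K \<le> r" using r K by (simp add: K_def field_simps add_nonneg_pos)
    then have small: "ennreal ((norm v)\<^sup>2 / K) < \<epsilon>"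
      using r by (meson ennreal_leI le_less_trans)
    have "\<forall>\<^sub>F T in at_top. ereal K < ereal (inverse ((\<gamma>T T)\<^sup>2)) *
              (INF \<psi>\<in>{\<psi>. norm \<psi> = 1}. ereal (gram_op C Q T \<psi> \<bullet> \<psi>))"
      using lim_B unfolding tendsto_PInfty by blast
    then show "\<forall>\<^sub>F T in at_top. ?risk T < \<epsilon>"
      using eventually_gt_at_top[of 0]
    proof eventually_elim
      case (elim T)
      from bound[OF elim(2) K elim(1)] small show ?case by (rule le_less_trans)
    qed
  qed simp
qed

end
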